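(* Let $\mathcal{L}$ be a class of languages that is closed under the operations of union and taking inverse images under length preserving morphisms. Then the class of $\mathcal{L}$-groups is closed under taking finite direct products: if $G_1,\dots,G_n$ ($n\ge 1$) are $\mathcal{L}$-groups, then $G_1\times\cdots\times G_n$ is an $\mathcal{L}$-group.
   Context: A language is a set $L\subseteq A^*$ of words over some finite alphabet $A$, where $A^*$ is the free monoid on $A$. Membership of a language in the class $\mathcal{L}$ depends only on the set of words, not on the alphabet over which it is considered: if $L\subseteq A^*$ and $A\subseteq A'$ with $A'$ finite, then $L$ viewed as a subset of $A^*$ is in $\mathcal{L}$ if and only if $L$ viewed as a subset of $(A')^*$ is. Closed under union means: if $L,L'\subseteq A^*$ are in $\mathcal{L}$ then so is $L\cup L'$. A length preserving morphism is a monoid homomorphism $\phi:A^*\to B^*$ ($A,B$ finite) such that $\phi(w)$ has the same length as $w$ for every $w\in A^*$; closed under inverse images under such morphisms means: if $L\subseteq B^*$ is in $\mathcal{L}$ then $\phi^{-1}(L)\subseteq A^*$ is in $\mathcal{L}$. A generating set $X$ of a group $G$ is symmetric if it is closed under taking inverses; it is allowed to contain the identity element. For a finite symmetric generating set $X$ of $G$, $\mathrm{Geo}(G,X)\subseteq X^*$ denotes the set of all words over $X$ that label geodesic paths in the Cayley graph of $G$ with respect to $X$, i.e. the words $w$ such that no strictly shorter word over $X$ represents the same element of $G$ as $w$. A group $G$ is an $\mathcal{L}$-group if $\mathrm{Geo}(G,X)$ is in $\mathcal{L}$ for some finite symmetric generating set $X$ of $G$. *)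

theory Defs
  imports "HOL-Algebra.Product_Groups" "HOL-Library.Infinite_Typeclass"
begin

text \<open>
  Words are lists and the free monoid on an alphabet \<open>A\<close> is \<open>lists A\<close>. All alphabets are finite
  subsets of one infinite type \<open>'s\<close> of symbols. A language is a bare set of words that does not
  record its alphabet, so whether it belongs to a class cannot depend on the alphabet over which
  it is considered.
\<close>

definition language_class :: "'s list set set \<Rightarrow> bool" where
  "language_class \<L> \<longleftrightarrow> (\<forall>K\<in>\<L>. \<exists>A. finite A \<and> K \<subseteq> lists A)"

definition closed_union :: "'s list set set \<Rightarrow> bool" where
  "closed_union \<L> \<longleftrightarrow>
     (\<forall>A K K'. finite A \<and> K \<subseteq> lists A \<and> K' \<subseteq> lists A \<and> K \<in> \<L> \<and> K' \<in> \<L> \<longrightarrow> K \<union> K' \<in> \<L>)"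

definition length_preserving_morphism ::
    "'s set \<Rightarrow> 't set \<Rightarrow> ('s list \<Rightarrow> 't list) \<Rightarrow> bool" where
  "length_preserving_morphism A B \<phi> \<longleftrightarrow>
     (\<forall>w\<in>lists A. \<phi> w \<in> lists B) \<and>
     \<phi> [] = [] \<and>
     (\<forall>u\<in>lists A. \<forall>v\<in>lists A. \<phi> (u @ v) = \<phi> u @ \<phi> v) \<and>
     (\<forall>w\<in>lists A. length (\<phi> w) = length w)"

definition closed_inverse_image :: "'s list set set \<Rightarrow> bool" where
  "closed_inverse_image \<L> \<longleftrightarrow>
     (\<forall>A B \<phi> K. finite A \<and> finite B \<and> length_preserving_morphism A B \<phi> \<and> K \<subseteq> lists B \<and> K \<in> \<L>
        \<longrightarrow> {w \<in> lists A. \<phi> w \<in> K} \<in> \<L>)"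

definition word_value :: "('g, 'm) monoid_scheme \<Rightarrow> 'g list \<Rightarrow> 'g" where
  "word_value G w = foldr (\<otimes>\<^bsub>G\<^esub>) w \<one>\<^bsub>G\<^esub>"

definition finite_symmetric_generating_set :: "('g, 'm) monoid_scheme \<Rightarrow> 'g set \<Rightarrow> bool" where
  "finite_symmetric_generating_set G X \<longleftrightarrow>
     finite X \<and> X \<subseteq> carrier G \<and> (\<forall>x\<in>X. inv\<^bsub>G\<^esub> x \<in> X) \<and> generate G X = carrier G"

definition Geo :: "('g, 'm) monoid_scheme \<Rightarrow> 'g set \<Rightarrow> 'g list set" where
  "Geo G X = {w \<in> lists X. \<not> (\<exists>v\<in>lists X. length v < length w \<and> word_value G v = word_value G w)}"

text \<open>
  \<open>Geo G X\<close> is a language over \<open>X \<subseteq> carrier G\<close>, whereas the members of \<open>\<L>\<close> are languages over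
  \<open>'s\<close>. Hence the letters are named by an injection \<open>f\<close> of the finite set \<open>X\<close> into \<open>'s\<close>. Such an
  injection always exists, and \<open>encoding_irrelevant\<close> below shows that its choice does not matter
  when \<open>\<L>\<close> is closed under inverse images of length preserving morphisms.
\<close>

definition L_group :: "('s::infinite) list set set \<Rightarrow> ('g, 'm) monoid_scheme \<Rightarrow> bool" where
  "L_group \<L> G \<longleftrightarrow>
     group G \<and>
     (\<exists>X. finite_symmetric_generating_set G X \<and>
          (\<exists>f :: 'g \<Rightarrow> 's. inj_on f X \<and> map f ` Geo G X \<in> \<L>))"

lemma encoding_irrelevant:
  fixes f g :: "'a \<Rightarrow> 's"
  assumes "closed_inverse_image \<L>" "finite X" "K \<subseteq> lists X"
    and f: "inj_on f X" and g: "inj_on g X" and mem: "map f ` K \<in> \<L>"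
  shows "map g ` K \<in> \<L>"
proof -
  define h where "h = f \<circ> inv_into X g"
  have hg: "map h (map g w) = map f w" if "w \<in> lists X" for w
    using that g by (auto simp: h_def)
  have "length_preserving_morphism (g ` X) (f ` X) (map h)"
    by (auto simp: length_preserving_morphism_def h_def intro!: imageI inv_into_into)
  moreover have "map f ` K \<subseteq> lists (f ` X)"
    using image_mono[OF assms(3), of "map f"] by (simp add: lists_image)
  ultimately have "{w \<in> lists (g ` X). map h w \<in> map f ` K} \<in> \<L>"
    using assms(1,2) mem unfolding closed_inverse_image_def by blast
  moreover have "{w \<in> lists (g ` X). map h w \<in> map f ` K} = map g ` K"
  proof (intro equalityI subsetI)
    fix w assume w: "w \<in> {w \<in> lists (g ` X). map h w \<in> map f ` K}"
    then obtain v where v: "v \<in> lists X" "w = map g v"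
      by (auto simp: lists_image)
    from w obtain u where u: "u \<in> K" "map h w = map f u" by auto
    with v hg have "map f v = map f u" by metis
    moreover have "u \<in> lists X" using u assms(3) by blast
    ultimately have "v = u"
      using v(1) inj_on_map_lists[OF f] by (blast dest: inj_onD)
    with u v show "w \<in> map g ` K" by blast
  next
    fix w assume "w \<in> map g ` K"
    then obtain u where u: "u \<in> K" "w = map g u" by auto
    then have "u \<in> lists X" using assms(3) by blast
    then have "w \<in> lists (g ` X)" "map h w = map f u"
      using u(2) hg by (auto simp only: lists_image)
    with u(1) show "w \<in> {w \<in> lists (g ` X). map h w \<in> map f ` K}" by blast
  qed
  ultimately show ?thesis by simp
qed

end

theory Submission
  imports Defs
begin

text \<open>
  Enlarge each generating set \<open>X\<^sub>i\<close> by the identity, which leaves the geodesic words unchanged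
  (\<open>Geo_insert_one\<close>): a word that uses the identity can be shortened by deleting it. Generate the
  product by the set of all tuples of such generators. A tuple of words of equal length is then
  the same thing as one word over the product set, evaluated componentwise, and shorter words can
  be padded by the identity to any common length. So a word of length \<open>k\<close> over the product set
  can be shortened if and only if the values of all its projections can be spelled with fewer than
  \<open>k\<close> letters. In other words, it is geodesic if and only if at least one of its projections is
  geodesic (\<open>Geo_product_group\<close>).

  Thus the geodesics of the product are a finite union of inverse images of the geodesics of the
  factors, under the projections, and these preserve length.
\<close>

section \<open>Values of words\<close>

lemma word_value_Nil [simp]: "word_value G [] = \<one>\<^bsub>G\<^esub>"
  and word_value_Cons [simp]: "word_value G (x # w) = x \<otimes>\<^bsub>G\<^esub> word_value G w"
  by (simp_all add: word_value_def)

context group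
begin

lemma word_value_closed:
  assumes "w \<in> lists (carrier G)"
  shows "word_value G w \<in> carrier G"
  using assms by (induction w) auto

lemma word_value_append:
  assumes "u \<in> lists (carrier G)" "v \<in> lists (carrier G)"
  shows "word_value G (u @ v) = word_value G u \<otimes> word_value G v"
  using assms by (induction u) (auto simp: word_value_closed m_assoc)

lemma word_value_removeAll_one:
  assumes "w \<in> lists (carrier G)"
  shows "word_value G (removeAll \<one> w) = word_value G w"
  using assms by (induction w) (auto simp: word_value_closed in_lists_conv_set)

lemma generate_eq_word_values:
  assumes "X \<subseteq> carrier G" and "\<forall>x\<in>X. inv x \<in> X"
  shows "generate G X = word_value G ` lists X"
proof (intro equalityI subsetI)
  fix g assume "g \<in> generate G X"
  then show "g \<in> word_value G ` lists X"
  proof (induction rule: generate.induct)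
    case one
    then show ?case by (auto intro!: image_eqI[of _ _ "[]"])
  next
    case (incl h)
    then show ?case using assms by (auto intro!: image_eqI[of _ _ "[h]"])
  next
    case (inv h)
    then show ?case using assms by (auto intro!: image_eqI[of _ _ "[inv h]"])
  next
    case (eng h1 h2)
    then obtain u v where uv: "u \<in> lists X" "v \<in> lists X" "h1 = word_value G u" "h2 = word_value G v"
      by auto
    moreover from this have "u \<in> lists (carrier G)" "v \<in> lists (carrier G)"
      using assms(1) lists_mono by blast+
    ultimately have "h1 \<otimes> h2 = word_value G (u @ v)" "u @ v \<in> lists X"
      by (simp_all add: word_value_append)
    then show ?case by (rule image_eqI)
  qed
next
  fix g assume "g \<in> word_value G ` lists X"
  then obtain w where "w \<in> lists X" "g = word_value G w" by auto
  then show "g \<in> generate G X"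
    by (induction w arbitrary: g) (auto intro: generate.intros)
qed

lemma exists_word_of_longer_length:
  assumes "X \<subseteq> carrier G" "\<one> \<in> X" "w \<in> lists X" "length w \<le> k"
  shows "\<exists>v\<in>lists X. length v = k \<and> word_value G v = word_value G w"
proof -
  have "word_value G (replicate m \<one>) = \<one>" for m
    by (induction m) auto
  moreover have "w \<in> lists (carrier G)"
    using assms(1,3) lists_mono by blast
  moreover have "replicate m \<one> \<in> lists (carrier G)" for m
    by (auto simp: in_lists_conv_set)
  ultimately have "word_value G (w @ replicate (k - length w) \<one>) = word_value G w"
    by (simp add: word_value_append word_value_closed)
  then show ?thesis
    using assms by (intro bexI[of _ "w @ replicate (k - length w) \<one>"]) auto
qed

lemma Geo_insert_one:
  assumes "X \<subseteq> carrier G"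
  shows "Geo G (insert \<one> X) = Geo G X"
proof -
  have shorten: "removeAll \<one> w \<in> lists X \<and> word_value G (removeAll \<one> w) = word_value G w"
    if "w \<in> lists (insert \<one> X)" for w
  proof -
    have "w \<in> lists (carrier G)" using that assms by auto
    then show ?thesis using that by (auto simp: word_value_removeAll_one)
  qed
  show ?thesis
  proof (intro equalityI subsetI)
    fix w assume w: "w \<in> Geo G (insert \<one> X)"
    then have w': "w \<in> lists (insert \<one> X)" by (simp add: Geo_def)
    have "\<one> \<notin> set w"
    proof
      assume "\<one> \<in> set w"
      then have "length (removeAll \<one> w) < length w" by (rule length_removeAll_less)
      moreover have "removeAll \<one> w \<in> lists (insert \<one> X)" using shorten[OF w'] by auto
      ultimately show False using w shorten[OF w'] by (auto simp: Geo_def)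
    qed
    then have "w \<in> lists X" using w' by auto
    then show "w \<in> Geo G X" using w by (fastforce simp: Geo_def)
  next
    fix w assume w: "w \<in> Geo G X"
    have False if v: "v \<in> lists (insert \<one> X)" "length v < length w" "word_value G v = word_value G w" for v
    proof -
      have "length (removeAll \<one> v) < length w"
        using le_less_trans[OF length_filter_le v(2)] by (simp add: removeAll_filter_not_eq)
      then show False using shorten[OF v(1)] v(3) w by (auto simp: Geo_def)
    qed
    then show "w \<in> Geo G (insert \<one> X)" using w by (auto simp: Geo_def)
  qed
qed

end

section \<open>Words and geodesics in a direct product\<close>

lemma exists_word_with_projections:
  assumes "\<And>i. i \<in> I \<Longrightarrow> u i \<in> lists (Y i)" and "\<And>i. i \<in> I \<Longrightarrow> length (u i) = k"
  shows "\<exists>w\<in>lists (PiE I Y). length w = k \<and> (\<forall>i\<in>I. map (\<lambda>z. z i) w = u i)"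
proof (intro bexI conjI ballI)
  let ?w = "map (\<lambda>j. \<lambda>i\<in>I. u i ! j) [0..<k]"
  show "?w \<in> lists (PiE I Y)"
    using assms by (fastforce simp: in_lists_conv_set)
  show "length ?w = k" by simp
  show "map (\<lambda>z. z i) ?w = u i" if "i \<in> I" for i
    using assms(2)[OF that] that by (auto intro: nth_equalityI)
qed

lemma word_value_product_group:
  "word_value (product_group I G) w = (\<lambda>i\<in>I. word_value (G i) (map (\<lambda>z. z i) w))"
  by (induction w) (auto simp: product_group_def)

text \<open>
  With the identity among the letters of each factor, representatives of the components that are
  too short can be padded. So the word length on the product is the maximum of the word lengths
  of the components.
\<close>

lemma exists_word_of_length_in_product:
  assumes "\<And>i. i \<in> I \<Longrightarrow> group (G i)"
    and "\<And>i. i \<in> I \<Longrightarrow> Y i \<subseteq> carrier (G i)" and "\<And>i. i \<in> I \<Longrightarrow> \<one>\<^bsub>G i\<^esub> \<in> Y i"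
    and "\<And>i. i \<in> I \<Longrightarrow> \<exists>v\<in>lists (Y i). length v \<le> k \<and> word_value (G i) v = g i"
    and "g \<in> extensional I"
  shows "\<exists>w\<in>lists (PiE I Y). length w = k \<and> word_value (product_group I G) w = g"
proof -
  have "\<forall>i\<in>I. \<exists>v. v \<in> lists (Y i) \<and> length v = k \<and> word_value (G i) v = g i"
  proof
    fix i assume i: "i \<in> I"
    then obtain v where "v \<in> lists (Y i)" "length v \<le> k" "word_value (G i) v = g i"
      using assms(4) by blast
    then show "\<exists>v. v \<in> lists (Y i) \<and> length v = k \<and> word_value (G i) v = g i"
      using group.exists_word_of_longer_length[OF assms(1)[OF i] assms(2)[OF i] assms(3)[OF i]]
      by metis
  qed
  then obtain u where u: "\<And>i. i \<in> I \<Longrightarrow> u i \<in> lists (Y i)" "\<And>i. i \<in> I \<Longrightarrow> length (u i) = k"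
      "\<And>i. i \<in> I \<Longrightarrow> word_value (G i) (u i) = g i"
    by metis
  from exists_word_with_projections[of I u Y k, OF u(1,2)]
  obtain w where w: "w \<in> lists (PiE I Y)" "length w = k" "\<forall>i\<in>I. map (\<lambda>z. z i) w = u i"
    by blast
  then have "word_value (product_group I G) w = g"
    using u(3) assms(5) by (auto simp: word_value_product_group fun_eq_iff extensional_def)
  with w show ?thesis by blast
qed

lemma finite_symmetric_generating_set_product_group:
  assumes "finite I" and grp: "\<And>i. i \<in> I \<Longrightarrow> group (G i)"
    and gen: "\<And>i. i \<in> I \<Longrightarrow> finite_symmetric_generating_set (G i) (Y i)"
    and one: "\<And>i. i \<in> I \<Longrightarrow> \<one>\<^bsub>G i\<^esub> \<in> Y i"
  shows "finite_symmetric_generating_set (product_group I G) (PiE I Y)"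
proof -
  interpret P: group "product_group I G" using grp by simp
  have Y: "finite (Y i)" "Y i \<subseteq> carrier (G i)" "\<forall>x\<in>Y i. inv\<^bsub>G i\<^esub> x \<in> Y i"
      "generate (G i) (Y i) = carrier (G i)" if "i \<in> I" for i
    using gen[OF that] by (auto simp: finite_symmetric_generating_set_def)
  have sub: "PiE I Y \<subseteq> carrier (product_group I G)"
    using Y(2) by (auto simp: PiE_iff)
  have sym: "\<forall>z\<in>PiE I Y. inv\<^bsub>product_group I G\<^esub> z \<in> PiE I Y"
  proof
    fix z assume z: "z \<in> PiE I Y"
    then have "inv\<^bsub>product_group I G\<^esub> z = (\<lambda>i\<in>I. inv\<^bsub>G i\<^esub> z i)"
      using sub grp by (intro inv_product_group) auto
    then show "inv\<^bsub>product_group I G\<^esub> z \<in> PiE I Y" using z Y(3) by auto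
  qed
  have "g \<in> generate (product_group I G) (PiE I Y)" if g: "g \<in> carrier (product_group I G)" for g
  proof -
    have "\<forall>i\<in>I. \<exists>v. v \<in> lists (Y i) \<and> word_value (G i) v = g i"
    proof
      fix i assume i: "i \<in> I"
      then have "g i \<in> generate (G i) (Y i)" using g Y(4) by auto
      then show "\<exists>v. v \<in> lists (Y i) \<and> word_value (G i) v = g i"
        using group.generate_eq_word_values[OF grp[OF i] Y(2,3)[OF i]] by auto
    qed
    then obtain u where u: "\<And>i. i \<in> I \<Longrightarrow> u i \<in> lists (Y i) \<and> word_value (G i) (u i) = g i"
      by metis
    \<comment> \<open>The sum serves only as a common upper bound for the lengths, to which all words are padded.\<close>
    have "\<exists>w\<in>lists (PiE I Y). length w = (\<Sum>i\<in>I. length (u i)) \<and> word_value (product_group I G) w = g"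
    proof (rule exists_word_of_length_in_product[OF grp Y(2) one])
      fix i assume i: "i \<in> I"
      then have "length (u i) \<le> (\<Sum>i\<in>I. length (u i))"
        using assms(1) by (intro member_le_sum) auto
      then show "\<exists>v\<in>lists (Y i). length v \<le> (\<Sum>i\<in>I. length (u i)) \<and> word_value (G i) v = g i"
        using u[OF i] by blast
    qed (use g in \<open>auto simp: PiE_iff\<close>)
    then show ?thesis
      using P.generate_eq_word_values[OF sub sym] by auto
  qed
  moreover have "generate (product_group I G) (PiE I Y) \<subseteq> carrier (product_group I G)"
    using P.generate_incl[OF sub] .
  ultimately show ?thesis
    using sub sym assms(1) Y(1)
    unfolding finite_symmetric_generating_set_def by (blast intro: finite_PiE)
qed

text \<open>
  A word is geodesic as soon as one projection is, because a shorter word with the same value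
  would project to a shorter word with the same value. Conversely, if every projection can be
  shortened, then pad the shortened words to one letter less than the given word and recombine
  them. For the empty index set this would fail: the empty word is geodesic but has no projection.
\<close>

lemma Geo_product_group:
  assumes grp: "\<And>i. i \<in> I \<Longrightarrow> group (G i)" and "I \<noteq> {}"
    and Y: "\<And>i. i \<in> I \<Longrightarrow> Y i \<subseteq> carrier (G i)" and one: "\<And>i. i \<in> I \<Longrightarrow> \<one>\<^bsub>G i\<^esub> \<in> Y i"
  shows "Geo (product_group I G) (PiE I Y) =
    (\<Union>i\<in>I. {w \<in> lists (PiE I Y). map (\<lambda>z. z i) w \<in> Geo (G i) (Y i)})"
proof (intro equalityI subsetI)
  fix w assume w: "w \<in> Geo (product_group I G) (PiE I Y)"
  then have wZ: "w \<in> lists (PiE I Y)" by (simp add: Geo_def)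
  have proj: "map (\<lambda>z. z i) w \<in> lists (Y i)" if "i \<in> I" for i
    using wZ that by (auto simp: in_lists_conv_set)
  have "\<exists>i\<in>I. map (\<lambda>z. z i) w \<in> Geo (G i) (Y i)"
  proof (rule ccontr)
    assume "\<not> ?thesis"
    then have short: "\<exists>v\<in>lists (Y i). length v < length w \<and>
        word_value (G i) v = word_value (G i) (map (\<lambda>z. z i) w)" if "i \<in> I" for i
      using proj that by (auto simp: Geo_def)
    with \<open>I \<noteq> {}\<close> have "w \<noteq> []" by fastforce
    have "\<exists>v\<in>lists (PiE I Y). length v = length w - 1 \<and>
        word_value (product_group I G) v = word_value (product_group I G) w"
    proof (rule exists_word_of_length_in_product[OF grp Y one])
      fix i assume i: "i \<in> I"
      from short[OF i] obtain v where "v \<in> lists (Y i)" "length v < length w"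
          "word_value (G i) v = word_value (G i) (map (\<lambda>z. z i) w)" by blast
      then show "\<exists>v\<in>lists (Y i). length v \<le> length w - 1 \<and>
          word_value (G i) v = word_value (product_group I G) w i"
        using i by (intro bexI[of _ v]) (auto simp: word_value_product_group)
    qed (auto simp: word_value_product_group)
    then obtain v where "v \<in> lists (PiE I Y)" "length v = length w - 1"
        "word_value (product_group I G) v = word_value (product_group I G) w" by blast
    moreover from this have "length v < length w" using \<open>w \<noteq> []\<close> by simp
    ultimately show False using w unfolding Geo_def by blast
  qed
  with wZ show "w \<in> (\<Union>i\<in>I. {w \<in> lists (PiE I Y). map (\<lambda>z. z i) w \<in> Geo (G i) (Y i)})"
    by blast
next
  fix w assume "w \<in> (\<Union>i\<in>I. {w \<in> lists (PiE I Y). map (\<lambda>z. z i) w \<in> Geo (G i) (Y i)})"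
  then obtain i where i: "i \<in> I" and wZ: "w \<in> lists (PiE I Y)"
    and geo: "map (\<lambda>z. z i) w \<in> Geo (G i) (Y i)" by blast
  have False if v: "v \<in> lists (PiE I Y)" "length v < length w"
    "word_value (product_group I G) v = word_value (product_group I G) w" for v
  proof -
    have "map (\<lambda>z. z i) v \<in> lists (Y i)"
      using v(1) i by (auto simp: in_lists_conv_set)
    moreover have "word_value (G i) (map (\<lambda>z. z i) v) = word_value (G i) (map (\<lambda>z. z i) w)"
      using fun_cong[OF v(3), of i] i by (simp add: word_value_product_group)
    moreover have "length (map (\<lambda>z. z i) v) < length (map (\<lambda>z. z i) w)"
      using v(2) by simp
    ultimately show False using geo unfolding Geo_def by blast
  qed
  with wZ show "w \<in> Geo (product_group I G) (PiE I Y)" by (auto simp: Geo_def)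
qed

section \<open>Closure properties of the class of languages\<close>

lemma finite_set_embeds_in_infinite_type:
  assumes "finite X"
  shows "\<exists>f :: 'a \<Rightarrow> 's::infinite. inj_on f X"
proof -
  obtain B :: "'s set" where "finite B" "card B = card X"
    using infinite_arbitrarily_large[OF infinite_UNIV] by metis
  then show ?thesis
    using finite_same_card_bij[OF assms] by (metis bij_betw_imp_inj_on)
qed

text \<open>
  Closure under inverse images, for letters that are named by symbols: a map \<open>p\<close> between the
  letters becomes the map \<open>g \<circ> p \<circ> f\<^sup>-\<^sup>1\<close> between their names.
\<close>

lemma inverse_image_letter_map:
  fixes f :: "'a \<Rightarrow> 's" and g :: "'b \<Rightarrow> 's"
  assumes "closed_inverse_image \<L>" "finite Z" "finite Y" "p ` Z \<subseteq> Y" "K \<subseteq> lists Y"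
    and f: "inj_on f Z" and g: "inj_on g Y" and mem: "map g ` K \<in> \<L>"
  shows "map f ` {w \<in> lists Z. map p w \<in> K} \<in> \<L>"
proof -
  define h where "h = g \<circ> p \<circ> inv_into Z f"
  have hf: "map h (map f w) = map g (map p w)" if "w \<in> lists Z" for w
    using that f by (auto simp: h_def)
  have "length_preserving_morphism (f ` Z) (g ` Y) (map h)"
    using assms(4) by (auto simp: length_preserving_morphism_def h_def in_lists_conv_set
        intro!: imageI inv_into_into)
  moreover have "map g ` K \<subseteq> lists (g ` Y)"
    using image_mono[OF assms(5), of "map g"] by (simp add: lists_image)
  ultimately have "{w \<in> lists (f ` Z). map h w \<in> map g ` K} \<in> \<L>"
    using assms(1-3) mem unfolding closed_inverse_image_def by blast
  also have "{w \<in> lists (f ` Z). map h w \<in> map g ` K} = map f ` {w \<in> lists Z. map h (map f w) \<in> map g ` K}"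
    unfolding lists_image by blast
  also have "{w \<in> lists Z. map h (map f w) \<in> map g ` K} = {w \<in> lists Z. map p w \<in> K}"
  proof (intro Collect_cong conj_cong refl)
    fix w assume w: "w \<in> lists Z"
    then have "map p w \<in> lists Y" using assms(4) by (auto simp: in_lists_conv_set)
    then show "map h (map f w) \<in> map g ` K \<longleftrightarrow> map p w \<in> K"
      unfolding hf[OF w] using inj_on_image_mem_iff[OF inj_on_map_lists[OF g]] assms(5) by blast
  qed
  finally show ?thesis .
qed

lemma closed_union_finite_Union:
  assumes "closed_union \<L>" "finite A" "finite I" "I \<noteq> {}"
    and "\<And>i. i \<in> I \<Longrightarrow> K i \<in> \<L> \<and> K i \<subseteq> lists A"
  shows "(\<Union>i\<in>I. K i) \<in> \<L>"
  using assms(3-5)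
proof (induction I rule: finite_ne_induct)
  case (singleton i)
  then show ?case by simp
next
  case (insert i J)
  then have "(\<Union>j\<in>J. K j) \<in> \<L>" "(\<Union>j\<in>J. K j) \<subseteq> lists A" "K i \<in> \<L>" "K i \<subseteq> lists A"
    by blast+
  then have "K i \<union> (\<Union>j\<in>J. K j) \<in> \<L>"
    using assms(1,2) unfolding closed_union_def by blast
  then show ?case by simp
qed

text \<open>
  Padding needs the identity among the generators, and adding it does not change the geodesics.
  But it then needs a name of its own as a letter, so the given naming is exchanged for one that
  is injective on the larger set.
\<close>

lemma L_group_generating_set_with_one:
  fixes \<L> :: "('s::infinite) list set set"
  assumes "closed_inverse_image \<L>" "L_group \<L> G"
  shows "\<exists>Y. finite_symmetric_generating_set G Y \<and> \<one>\<^bsub>G\<^esub> \<in> Y \<and>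
    (\<exists>f. inj_on f Y \<and> map f ` Geo G Y \<in> \<L>)"
proof -
  interpret group G using assms(2) by (simp add: L_group_def)
  obtain X and f :: "'a \<Rightarrow> 's" where X: "finite_symmetric_generating_set G X"
    and f: "inj_on f X" "map f ` Geo G X \<in> \<L>"
    using assms(2) unfolding L_group_def by blast
  have X': "finite X" "X \<subseteq> carrier G" "\<forall>x\<in>X. inv\<^bsub>G\<^esub> x \<in> X" "generate G X = carrier G"
    using X by (auto simp: finite_symmetric_generating_set_def)
  obtain g :: "'a \<Rightarrow> 's" where g: "inj_on g (insert \<one>\<^bsub>G\<^esub> X)"
    using finite_set_embeds_in_infinite_type[of "insert \<one>\<^bsub>G\<^esub> X"] X'(1) by blast
  have "map g ` Geo G X \<in> \<L>"
    using encoding_irrelevant[OF assms(1) X'(1) _ f(1) _ f(2)] g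
    by (auto simp: Geo_def inj_on_insert)
  moreover have "generate G (insert \<one>\<^bsub>G\<^esub> X) = carrier G"
    using mono_generate[of X "insert \<one>\<^bsub>G\<^esub> X"] generate_incl[of "insert \<one>\<^bsub>G\<^esub> X"] X' by auto
  ultimately show ?thesis
    using g X' Geo_insert_one[OF X'(2)]
    by (intro exI[of _ "insert \<one>\<^bsub>G\<^esub> X"]) (auto simp: finite_symmetric_generating_set_def)
qed

section \<open>Direct products\<close>

theorem theorem4p2:
  fixes \<L> :: "('s::infinite) list set set"
    and n :: nat
    and G :: "nat \<Rightarrow> ('g, 'm) monoid_scheme"
  assumes "language_class \<L>"
    and "closed_union \<L>"
    and "closed_inverse_image \<L>"
    and "n \<ge> 1"
    and "\<And>i. i \<in> {1..n} \<Longrightarrow> L_group \<L> (G i)"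
  shows "L_group \<L> (product_group {1..n} G)"
proof -
  let ?I = "{1..n}"
  let ?P = "product_group ?I G"
  have grp: "group (G i)" if "i \<in> ?I" for i
    using assms(5)[OF that] by (simp add: L_group_def)
  have "\<forall>i\<in>?I. \<exists>Y g. finite_symmetric_generating_set (G i) Y \<and> \<one>\<^bsub>G i\<^esub> \<in> Y \<and>
      inj_on g Y \<and> map g ` Geo (G i) Y \<in> \<L>"
    using L_group_generating_set_with_one[OF assms(3,5)] by blast
  then obtain Y and g :: "nat \<Rightarrow> 'g \<Rightarrow> 's" where
    gen: "\<And>i. i \<in> ?I \<Longrightarrow> finite_symmetric_generating_set (G i) (Y i)"
    and one: "\<And>i. i \<in> ?I \<Longrightarrow> \<one>\<^bsub>G i\<^esub> \<in> Y i"
    and inj: "\<And>i. i \<in> ?I \<Longrightarrow> inj_on (g i) (Y i)"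
    and mem: "\<And>i. i \<in> ?I \<Longrightarrow> map (g i) ` Geo (G i) (Y i) \<in> \<L>"
    by metis
  let ?Z = "PiE ?I Y"
  have Y: "finite (Y i)" "Y i \<subseteq> carrier (G i)" if "i \<in> ?I" for i
    using gen[OF that] by (auto simp: finite_symmetric_generating_set_def)
  have genP: "finite_symmetric_generating_set ?P ?Z"
    by (rule finite_symmetric_generating_set_product_group[OF finite_atLeastAtMost grp gen one])
  then have finZ: "finite ?Z" by (simp add: finite_symmetric_generating_set_def)
  then obtain f :: "(nat \<Rightarrow> 'g) \<Rightarrow> 's" where f: "inj_on f ?Z"
    using finite_set_embeds_in_infinite_type by blast
  let ?K = "\<lambda>i. {w \<in> lists ?Z. map (\<lambda>z. z i) w \<in> Geo (G i) (Y i)}"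
  have "map f ` ?K i \<in> \<L>" if i: "i \<in> ?I" for i
    by (rule inverse_image_letter_map[OF assms(3) finZ Y(1)[OF i] _ _ f inj[OF i] mem[OF i]])
      (use i in \<open>auto simp: Geo_def PiE_iff\<close>)
  moreover have "map f ` ?K i \<subseteq> lists (f ` ?Z)" for i
    unfolding lists_image by blast
  ultimately have "(\<Union>i\<in>?I. map f ` ?K i) \<in> \<L>"
    using assms(4) finZ by (intro closed_union_finite_Union[OF assms(2), of "f ` ?Z"]) auto
  moreover have "Geo ?P ?Z = (\<Union>i\<in>?I. ?K i)"
    using assms(4) by (intro Geo_product_group grp Y(2) one) auto
  ultimately have "map f ` Geo ?P ?Z \<in> \<L>" by (simp add: image_UN)
  then show ?thesis
    unfolding L_group_def
    by (intro conjI product_group grp exI[of _ ?Z] exI[of _ f] genP f)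
qed

end
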